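(* Let $n\ge 3$ and let $\mathcal{R}$ be an integral domain containing $\mathbb{Z}$. Let $Z_n$ be the directed graph with the $n$ vertices $a,b,v_3,v_4,\dots,v_n$ and with edges $a\to v_i$ and $v_i\to b$ for all $i\in\{3,\dots,n\}$ (and no other edges). Let the weight function $f$ on $Z_n$ be defined by $f_{av_i}=1$ and $f_{v_ib}=2^i$ for all $i$. Then $R_f$ is an effective representation of the Hecke-Kiselman monoid $HK_{Z_n}$.
   Context: For a finite directed graph $\Gamma$ without loops and with at most one directed edge between any pair of vertices, the Hecke-Kiselman monoid $HK_\Gamma$ is the quotient of the free monoid $V(\Gamma)^*$ on the vertex set by the relations: $x^2=x$ for all $x\in V(\Gamma)$; $xy=yx$ if there is no edge between $x$ and $y$; $xyx=yxy=xy$ if there is an edge $x\to y$. Let $W=\bigoplus_{v\in V(\Gamma)}\mathcal{R}v$. A weight function is a function $f:E(\Gamma)\to\mathcal{R}\setminus\{0\}$; write $f_{xy}$ for the weight of $x\to y$. For $x\in V(\Gamma)$ let $\theta_x^f\in \mathrm{End}_{\mathcal{R}}(W)$ be the linear map with $\theta_x^f(y)=y$ for vertices $y\neq x$ and $\theta_x^f(x)=\sum_{z\to x}f_{zx}z$ (an empty sum is $0$). The assignment $x\mapsto\theta_x^f$ extends to a monoid homomorphism $R_f:HK_\Gamma\to \mathrm{End}_{\mathcal{R}}(W)$ (product being composition, $R_f([xy])=\theta^f_x\circ\theta^f_y$). A representation is effective if it is injective as a map on the monoid. *)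

theory Defs
  imports "HOL-Algebra.Group" "Graph_Theory.Pair_Digraph"
begin

section \<open>Monoids given by generators and relations\<close>

text \<open>The least monoid congruence on the free monoid \<open>lists A\<close> that contains \<open>\<rho>\<close>.\<close>

inductive_set word_cong :: "'a set \<Rightarrow> ('a list \<times> 'a list) set \<Rightarrow> ('a list \<times> 'a list) set"
  for A \<rho> where
  rel: "(u, v) \<in> \<rho> \<Longrightarrow> u \<in> lists A \<Longrightarrow> v \<in> lists A \<Longrightarrow> (u, v) \<in> word_cong A \<rho>"
| refl: "u \<in> lists A \<Longrightarrow> (u, u) \<in> word_cong A \<rho>"
| sym: "(u, v) \<in> word_cong A \<rho> \<Longrightarrow> (v, u) \<in> word_cong A \<rho>"
| trans: "(u, v) \<in> word_cong A \<rho> \<Longrightarrow> (v, w) \<in> word_cong A \<rho> \<Longrightarrow> (u, w) \<in> word_cong A \<rho>"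
| append: "(u, v) \<in> word_cong A \<rho> \<Longrightarrow> (u', v') \<in> word_cong A \<rho> \<Longrightarrow> (u @ u', v @ v') \<in> word_cong A \<rho>"

definition presented_monoid :: "'a set \<Rightarrow> ('a list \<times> 'a list) set \<Rightarrow> 'a list set monoid" where
  "presented_monoid A \<rho> =
    \<lparr>carrier = lists A // word_cong A \<rho>,
     monoid.mult = (\<lambda>X Y. \<Union>u\<in>X. \<Union>v\<in>Y. word_cong A \<rho> `` {u @ v}),
     one = word_cong A \<rho> `` {[]}\<rparr>"

lemma word_cong_lists:
  assumes "(u, v) \<in> word_cong A \<rho>"
  shows "u \<in> lists A \<and> v \<in> lists A"
  using assms by induction auto

lemma equiv_word_cong: "equiv (lists A) (word_cong A \<rho>)"
proof (rule equivI)
  show "word_cong A \<rho> \<subseteq> lists A \<times> lists A"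
    using word_cong_lists by fastforce
  show "refl_on (lists A) (word_cong A \<rho>)"
    by (auto intro!: refl_onI word_cong.refl)
  show "Relation.sym (word_cong A \<rho>)"
    by (auto intro!: symI word_cong.sym)
  show "Relation.trans (word_cong A \<rho>)"
    by (rule transI) (rule word_cong.trans)
qed

lemma presented_monoid_mult:
  assumes "u \<in> lists A" "v \<in> lists A"
  shows "(word_cong A \<rho> `` {u}) \<otimes>\<^bsub>presented_monoid A \<rho>\<^esub> (word_cong A \<rho> `` {v}) = word_cong A \<rho> `` {u @ v}"
proof -
  have "word_cong A \<rho> `` {u' @ v'} = word_cong A \<rho> `` {u @ v}"
    if "(u, u') \<in> word_cong A \<rho>" "(v, v') \<in> word_cong A \<rho>" for u' v'
    using equiv_class_eq[OF equiv_word_cong word_cong.append[OF that]] by simp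
  moreover have "(u, u) \<in> word_cong A \<rho>" "(v, v) \<in> word_cong A \<rho>"
    using assms by (auto intro: word_cong.refl)
  ultimately have "(\<Union>u'\<in>word_cong A \<rho> `` {u}. \<Union>v'\<in>word_cong A \<rho> `` {v}. word_cong A \<rho> `` {u' @ v'})
      = word_cong A \<rho> `` {u @ v}"
    by blast
  then show ?thesis
    by (simp add: presented_monoid_def)
qed

lemma monoid_presented_monoid: "monoid (presented_monoid A \<rho>)"
proof (rule monoidI)
  let ?M = "presented_monoid A \<rho>"
  have ex: "\<exists>u\<in>lists A. X = word_cong A \<rho> `` {u}" if "X \<in> carrier ?M" for X
    using that by (auto simp: presented_monoid_def quotient_def)
  have cl: "word_cong A \<rho> `` {u} \<in> carrier ?M" if "u \<in> lists A" for u
    using that by (auto simp: presented_monoid_def quotient_def)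
  have one: "\<one>\<^bsub>?M\<^esub> = word_cong A \<rho> `` {[]}"
    by (simp add: presented_monoid_def)
  show "x \<otimes>\<^bsub>?M\<^esub> y \<in> carrier ?M" if xy: "x \<in> carrier ?M" "y \<in> carrier ?M" for x y
  proof -
    obtain u v where uv: "u \<in> lists A" "v \<in> lists A"
      "x = word_cong A \<rho> `` {u}" "y = word_cong A \<rho> `` {v}"
      using ex[OF xy(1)] ex[OF xy(2)] by blast
    then have "u @ v \<in> lists A" by simp
    from cl[OF this] uv show ?thesis by (simp only: presented_monoid_mult)
  qed
  show "\<one>\<^bsub>?M\<^esub> \<in> carrier ?M"
    using one cl[of "[]"] by simp
  show "x \<otimes>\<^bsub>?M\<^esub> y \<otimes>\<^bsub>?M\<^esub> z = x \<otimes>\<^bsub>?M\<^esub> (y \<otimes>\<^bsub>?M\<^esub> z)"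
    if xyz: "x \<in> carrier ?M" "y \<in> carrier ?M" "z \<in> carrier ?M" for x y z
  proof -
    obtain u v w where "u \<in> lists A" "v \<in> lists A" "w \<in> lists A"
      "x = word_cong A \<rho> `` {u}" "y = word_cong A \<rho> `` {v}" "z = word_cong A \<rho> `` {w}"
      using ex[OF xyz(1)] ex[OF xyz(2)] ex[OF xyz(3)] by blast
    then show ?thesis
      by (simp add: presented_monoid_mult)
  qed
  show "\<one>\<^bsub>?M\<^esub> \<otimes>\<^bsub>?M\<^esub> x = x" "x \<otimes>\<^bsub>?M\<^esub> \<one>\<^bsub>?M\<^esub> = x" if x: "x \<in> carrier ?M" for x
  proof -
    obtain u where "u \<in> lists A" "x = word_cong A \<rho> `` {u}"
      using ex[OF x] by blast
    then show "\<one>\<^bsub>?M\<^esub> \<otimes>\<^bsub>?M\<^esub> x = x" "x \<otimes>\<^bsub>?M\<^esub> \<one>\<^bsub>?M\<^esub> = x"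
      using presented_monoid_mult[of "[]" A u \<rho>] presented_monoid_mult[of u A "[]" \<rho>]
      by (simp_all add: one)
  qed
qed


section \<open>Hecke-Kiselman monoids\<close>

locale hk_digraph = pair_digraph G for G :: "'a pair_pre_digraph" +
  assumes at_most_one_arc: "(x, y) \<in> parcs G \<Longrightarrow> (y, x) \<notin> parcs G"

definition hk_relations :: "'a pair_pre_digraph \<Rightarrow> ('a list \<times> 'a list) set" where
  "hk_relations G =
     {([x, x], [x]) | x. x \<in> pverts G} \<union>
     {([x, y], [y, x]) | x y. x \<in> pverts G \<and> y \<in> pverts G \<and> (x, y) \<notin> parcs G \<and> (y, x) \<notin> parcs G} \<union>
     {([x, y, x], [x, y]) | x y. (x, y) \<in> parcs G} \<union>
     {([y, x, y], [x, y]) | x y. (x, y) \<in> parcs G}"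

definition HK :: "'a pair_pre_digraph \<Rightarrow> 'a list set monoid" where
  "HK G = presented_monoid (pverts G) (hk_relations G)"

definition hk_class :: "'a pair_pre_digraph \<Rightarrow> 'a list \<Rightarrow> 'a list set" where
  "hk_class G w = word_cong (pverts G) (hk_relations G) `` {w}"


section \<open>Free modules and their endomorphisms\<close>

text \<open>The free module on \<open>V\<close>. It is only used for finite \<open>V\<close>,
  so no finiteness condition on the support is needed.\<close>

definition free_module :: "'a set \<Rightarrow> ('a \<Rightarrow> 'r::comm_ring_1) set" where
  "free_module V = {w. \<forall>v. v \<notin> V \<longrightarrow> w v = 0}"

definition basis_vec :: "'a \<Rightarrow> 'a \<Rightarrow> 'r::comm_ring_1" where
  "basis_vec y = (\<lambda>v. if v = y then 1 else 0)"

text \<open>Endomorphisms are taken to be extensional functions on the module, so that equality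
  in the carrier is equality of linear maps.\<close>

definition End_monoid :: "'a set \<Rightarrow> (('a \<Rightarrow> 'r::comm_ring_1) \<Rightarrow> ('a \<Rightarrow> 'r)) monoid" where
  "End_monoid V =
    \<lparr>carrier = {\<phi> \<in> free_module V \<rightarrow>\<^sub>E free_module V.
        (\<forall>w\<in>free_module V. \<forall>w'\<in>free_module V. \<phi> (\<lambda>v. w v + w' v) = (\<lambda>v. \<phi> w v + \<phi> w' v)) \<and>
        (\<forall>c. \<forall>w\<in>free_module V. \<phi> (\<lambda>v. c * w v) = (\<lambda>v. c * \<phi> w v))},
     monoid.mult = compose (free_module V),
     one = (\<lambda>w\<in>free_module V. w)\<rparr>"

lemma monoid_End_monoid: "monoid (End_monoid V :: (('a \<Rightarrow> 'r::comm_ring_1) \<Rightarrow> _) monoid)"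
proof (rule monoidI)
  let ?W = "free_module V :: ('a \<Rightarrow> 'r) set" and ?E = "End_monoid V :: (('a \<Rightarrow> 'r) \<Rightarrow> _) monoid"
  have add: "(\<lambda>v. w v + w' v) \<in> ?W" and scale: "(\<lambda>v. c * w v) \<in> ?W"
    if "w \<in> ?W" "w' \<in> ?W" for w w' c
    using that by (auto simp: free_module_def)
  show "\<one>\<^bsub>?E\<^esub> \<in> carrier ?E"
    by (auto simp: End_monoid_def add scale)
  show "\<phi> \<otimes>\<^bsub>?E\<^esub> \<psi> \<in> carrier ?E" if "\<phi> \<in> carrier ?E" "\<psi> \<in> carrier ?E" for \<phi> \<psi>
  proof -
    have "\<phi> w \<in> ?W" "\<psi> w \<in> ?W" if "w \<in> ?W" for w
      using \<open>\<phi> \<in> carrier ?E\<close> \<open>\<psi> \<in> carrier ?E\<close> that by (auto simp: End_monoid_def)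
    then show ?thesis
      using that by (simp add: End_monoid_def compose_def add scale)
  qed
  show "\<phi> \<otimes>\<^bsub>?E\<^esub> \<psi> \<otimes>\<^bsub>?E\<^esub> \<chi> = \<phi> \<otimes>\<^bsub>?E\<^esub> (\<psi> \<otimes>\<^bsub>?E\<^esub> \<chi>)"
    if "\<phi> \<in> carrier ?E" "\<psi> \<in> carrier ?E" "\<chi> \<in> carrier ?E" for \<phi> \<psi> \<chi>
    using that by (auto simp: End_monoid_def compose_def PiE_iff restrict_def fun_eq_iff)
  show "\<one>\<^bsub>?E\<^esub> \<otimes>\<^bsub>?E\<^esub> \<phi> = \<phi>" "\<phi> \<otimes>\<^bsub>?E\<^esub> \<one>\<^bsub>?E\<^esub> = \<phi>" if "\<phi> \<in> carrier ?E" for \<phi>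
    using that by (auto simp: End_monoid_def compose_def PiE_iff restrict_def extensional_def)
qed


section \<open>The representation attached to a weight function\<close>

definition weight_function :: "'a pair_pre_digraph \<Rightarrow> ('a \<times> 'a \<Rightarrow> 'r::comm_ring_1) \<Rightarrow> bool" where
  "weight_function G f \<longleftrightarrow> (\<forall>e\<in>parcs G. f e \<noteq> 0)"

definition theta_basis ::
  "'a pair_pre_digraph \<Rightarrow> ('a \<times> 'a \<Rightarrow> 'r::comm_ring_1) \<Rightarrow> 'a \<Rightarrow> 'a \<Rightarrow> ('a \<Rightarrow> 'r)" where
  "theta_basis G f x y =
     (if y = x then (\<lambda>v. \<Sum>z | (z, x) \<in> parcs G. f (z, x) * basis_vec z v) else basis_vec y)"

definition theta ::
  "'a pair_pre_digraph \<Rightarrow> ('a \<times> 'a \<Rightarrow> 'r::comm_ring_1) \<Rightarrow> 'a \<Rightarrow> ('a \<Rightarrow> 'r) \<Rightarrow> ('a \<Rightarrow> 'r)" where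
  "theta G f x = (\<lambda>w\<in>free_module (pverts G). \<lambda>v. \<Sum>y\<in>pverts G. w y * theta_basis G f x y v)"

definition rep_word ::
  "'a pair_pre_digraph \<Rightarrow> ('a \<times> 'a \<Rightarrow> 'r::comm_ring_1) \<Rightarrow> 'a list \<Rightarrow> ('a \<Rightarrow> 'r) \<Rightarrow> ('a \<Rightarrow> 'r)" where
  "rep_word G f w =
     foldr (\<lambda>x \<phi>. theta G f x \<otimes>\<^bsub>End_monoid (pverts G)\<^esub> \<phi>) w \<one>\<^bsub>End_monoid (pverts G)\<^esub>"

text \<open>\<open>rep_word G f\<close> is constant on each class; see \<open>HK_rep_class\<close> below.\<close>

definition HK_rep ::
  "'a pair_pre_digraph \<Rightarrow> ('a \<times> 'a \<Rightarrow> 'r::comm_ring_1) \<Rightarrow> 'a list set \<Rightarrow> ('a \<Rightarrow> 'r) \<Rightarrow> ('a \<Rightarrow> 'r)" where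
  "HK_rep G f X = the_elem (rep_word G f ` X)"

definition representation ::
  "'m monoid \<Rightarrow> 'a set \<Rightarrow> ('m \<Rightarrow> ('a \<Rightarrow> 'r::comm_ring_1) \<Rightarrow> ('a \<Rightarrow> 'r)) \<Rightarrow> bool" where
  "representation M V \<rho> \<longleftrightarrow> \<rho> \<in> hom M (End_monoid V) \<and> \<rho> \<one>\<^bsub>M\<^esub> = \<one>\<^bsub>End_monoid V\<^esub>"

definition effective_representation ::
  "'m monoid \<Rightarrow> 'a set \<Rightarrow> ('m \<Rightarrow> ('a \<Rightarrow> 'r::comm_ring_1) \<Rightarrow> ('a \<Rightarrow> 'r)) \<Rightarrow> bool" where
  "effective_representation M V \<rho> \<longleftrightarrow> representation M V \<rho> \<and> inj_on \<rho> (carrier M)"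

context hk_digraph
begin

lemma theta_apply:
  assumes "x \<in> pverts G" "w \<in> free_module (pverts G)"
  shows "theta G f x w =
    (\<lambda>v. (if v = x then 0 else w v) + w x * (if (v, x) \<in> parcs G then f (v, x) else 0))"
proof
  fix v
  have fin: "finite (pverts G)" by (rule pair_finite_verts)
  have "finite {z. (z, x) \<in> parcs G}"
    by (rule finite_subset[OF _ fin]) (auto dest: arc_fst_in_verts)
  then have col: "theta_basis G f x x v = (if (v, x) \<in> parcs G then f (v, x) else 0)"
    by (simp add: theta_basis_def basis_vec_def if_distrib[of "\<lambda>t. _ * t"] sum.delta' cong: if_cong)
  have "theta G f x w v = (\<Sum>y\<in>pverts G. w y * theta_basis G f x y v)"
    using assms(2) by (simp add: theta_def)
  also have "\<dots> = w x * theta_basis G f x x v + (\<Sum>y\<in>pverts G - {x}. w y * theta_basis G f x y v)"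
    using fin assms(1) by (rule sum.remove)
  also have "(\<Sum>y\<in>pverts G - {x}. w y * theta_basis G f x y v)
      = (\<Sum>y\<in>pverts G - {x}. if v = y then w y else 0)"
    by (rule sum.cong) (auto simp: theta_basis_def basis_vec_def)
  also have "\<dots> = (if v = x then 0 else w v)"
    using fin assms(2) by (auto simp: free_module_def)
  finally show "theta G f x w v =
      (if v = x then 0 else w v) + w x * (if (v, x) \<in> parcs G then f (v, x) else 0)"
    using col by simp
qed

lemma theta_closed:
  assumes "x \<in> pverts G"
  shows "theta G f x \<in> carrier (End_monoid (pverts G))"
proof -
  have mem: "theta G f x w \<in> free_module (pverts G)" if "w \<in> free_module (pverts G)" for w
    using theta_apply[OF assms that] that assms
    by (auto simp: free_module_def dest: arc_fst_in_verts)
  have add: "(\<lambda>v. w v + w' v) \<in> free_module (pverts G)" and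
    scale: "(\<lambda>v. c * w v) \<in> free_module (pverts G)"
    if "w \<in> free_module (pverts G)" "w' \<in> free_module (pverts G)" for w w' :: "'a \<Rightarrow> 'b" and c
    using that by (auto simp: free_module_def)
  have "theta G f x \<in> extensional (free_module (pverts G))"
    by (simp add: theta_def)
  then show ?thesis
    using mem assms
    by (auto simp: End_monoid_def PiE_iff theta_apply add scale fun_eq_iff algebra_simps)
qed

lemma rep_word_closed:
  "w \<in> lists (pverts G) \<Longrightarrow> rep_word G f w \<in> carrier (End_monoid (pverts G))"
  by (induction w)
    (auto simp: rep_word_def intro!: monoid.m_closed[OF monoid_End_monoid] theta_closed
      monoid.one_closed[OF monoid_End_monoid])

lemma rep_word_append:
  assumes "v \<in> lists (pverts G)"
  shows "u \<in> lists (pverts G) \<Longrightarrow>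
    rep_word G f (u @ v) = rep_word G f u \<otimes>\<^bsub>End_monoid (pverts G)\<^esub> rep_word G f v"
proof (induction u)
  case Nil
  then show ?case
    using monoid.l_one[OF monoid_End_monoid rep_word_closed[OF assms, of f]]
    by (simp add: rep_word_def)
next
  case (Cons x u)
  then have "rep_word G f (x # u @ v) = theta G f x \<otimes>\<^bsub>End_monoid (pverts G)\<^esub>
      (rep_word G f u \<otimes>\<^bsub>End_monoid (pverts G)\<^esub> rep_word G f v)"
    by (simp add: rep_word_def)
  also have "\<dots> = (theta G f x \<otimes>\<^bsub>End_monoid (pverts G)\<^esub> rep_word G f u) \<otimes>\<^bsub>End_monoid (pverts G)\<^esub> rep_word G f v"
    using Cons assms by (subst monoid.m_assoc[OF monoid_End_monoid])
      (auto intro!: theta_closed rep_word_closed)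
  finally show ?case by (simp add: rep_word_def)
qed

lemma rep_word_apply:
  assumes "w \<in> free_module (pverts G)"
  shows "rep_word G f [] w = w" "rep_word G f (x # u) w = theta G f x (rep_word G f u w)"
  using assms by (auto simp: rep_word_def End_monoid_def compose_def)

lemma theta_mem:
  assumes "x \<in> pverts G" "w \<in> free_module (pverts G)"
  shows "theta G f x w \<in> free_module (pverts G)"
  using theta_closed[OF assms(1), of f] assms(2) by (auto simp: End_monoid_def)

lemma rep_word_relation:
  assumes "(u, v) \<in> hk_relations G"
  shows "rep_word G f u = rep_word G f v"
proof -
  have E: "x \<in> pverts G \<and> y \<in> pverts G \<and> x \<noteq> y \<and> (y, x) \<notin> parcs G" if "(x, y) \<in> parcs G" for x y
    using that at_most_one_arc arc_fst_in_verts arc_snd_in_verts by fastforce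
  have L: "(x, x) \<notin> parcs G" for x using at_most_one_arc by blast
  have uv: "u \<in> lists (pverts G)" "v \<in> lists (pverts G)"
    using assms by (auto simp: hk_relations_def dest: E)
  have ext: "rep_word G f u \<in> extensional (free_module (pverts G))"
    "rep_word G f v \<in> extensional (free_module (pverts G))"
    using rep_word_closed[of _ f] uv by (auto simp: End_monoid_def PiE_iff)
  have "rep_word G f u w = rep_word G f v w" if w: "w \<in> free_module (pverts G)" for w
  proof -
    have at: "theta G f x w v =
        (if v = x then 0 else w v) + w x * (if (v, x) \<in> parcs G then f (v, x) else 0)"
      if "x \<in> pverts G" "w \<in> free_module (pverts G)" for x v w
      using theta_apply[OF that] by simp
    note simps = rep_word_apply theta_mem at fun_eq_iff L w
    from assms consider
      (idem) x where "x \<in> pverts G" "u = [x, x]" "v = [x]"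
      | (comm) x y where "x \<in> pverts G" "y \<in> pverts G" "(x, y) \<notin> parcs G" "(y, x) \<notin> parcs G"
          "u = [x, y]" "v = [y, x]"
      | (arc1) x y where "(x, y) \<in> parcs G" "u = [x, y, x]" "v = [x, y]"
      | (arc2) x y where "(x, y) \<in> parcs G" "u = [y, x, y]" "v = [x, y]"
      unfolding hk_relations_def by blast
    then show ?thesis
    proof cases
      case idem
      then show ?thesis by (simp add: simps)
    next
      case comm
      then show ?thesis by (simp add: simps)
    next
      case arc1
      with E[OF arc1(1)] show ?thesis by (auto simp: simps algebra_simps)
    next
      case arc2
      with E[OF arc2(1)] show ?thesis by (auto simp: simps algebra_simps)
    qed
  qed
  then show ?thesis
    by (rule extensionalityI[OF ext])
qed

lemma rep_word_cong:
  assumes "(u, v) \<in> word_cong (pverts G) (hk_relations G)"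
  shows "rep_word G f u = rep_word G f v"
  using assms
proof induction
  case (append u v u' v')
  then show ?case
    using word_cong_lists[OF append.hyps(1)] word_cong_lists[OF append.hyps(2)]
    by (simp add: rep_word_append)
qed (simp_all add: rep_word_relation)

lemma HK_rep_class:
  assumes "w \<in> lists (pverts G)"
  shows "HK_rep G f (hk_class G w) = rep_word G f w"
proof -
  have "rep_word G f ` hk_class G w = {rep_word G f w}"
  proof (intro equalityI subsetI)
    fix \<phi> assume "\<phi> \<in> rep_word G f ` hk_class G w"
    then obtain u where "(w, u) \<in> word_cong (pverts G) (hk_relations G)" "\<phi> = rep_word G f u"
      unfolding hk_class_def by blast
    then show "\<phi> \<in> {rep_word G f w}"
      using rep_word_cong[of w u f] by simp
  next
    fix \<phi> assume "\<phi> \<in> {rep_word G f w}"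
    then show "\<phi> \<in> rep_word G f ` hk_class G w"
      using word_cong.refl[OF assms, of "hk_relations G"] by (simp add: hk_class_def)
  qed
  then show ?thesis by (simp add: HK_rep_def)
qed

lemma HK_rep_generator:
  assumes "x \<in> pverts G"
  shows "HK_rep G f (hk_class G [x]) = theta G f x"
  using HK_rep_class[of "[x]" f] assms
    monoid.r_one[OF monoid_End_monoid theta_closed[OF assms], of f]
  by (simp add: rep_word_def)

theorem representation_HK_rep: "representation (HK G) (pverts G) (HK_rep G f)"
proof -
  have ex: "\<exists>u\<in>lists (pverts G). X = hk_class G u" if "X \<in> carrier (HK G)" for X
    using that by (auto simp: HK_def presented_monoid_def quotient_def hk_class_def)
  have mult: "hk_class G u \<otimes>\<^bsub>HK G\<^esub> hk_class G v = hk_class G (u @ v)"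
    if "u \<in> lists (pverts G)" "v \<in> lists (pverts G)" for u v
    using presented_monoid_mult[OF that] by (simp add: HK_def hk_class_def)
  have "HK_rep G f \<in> hom (HK G) (End_monoid (pverts G))"
  proof (rule homI)
    fix X assume "X \<in> carrier (HK G)"
    then show "HK_rep G f X \<in> carrier (End_monoid (pverts G))"
      using ex HK_rep_class rep_word_closed by metis
  next
    fix X Y assume "X \<in> carrier (HK G)" "Y \<in> carrier (HK G)"
    then obtain u v where uv: "u \<in> lists (pverts G)" "v \<in> lists (pverts G)"
      "X = hk_class G u" "Y = hk_class G v" using ex by metis
    then have "u @ v \<in> lists (pverts G)" by simp
    with uv show "HK_rep G f (X \<otimes>\<^bsub>HK G\<^esub> Y) = HK_rep G f X \<otimes>\<^bsub>End_monoid (pverts G)\<^esub> HK_rep G f Y"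
      by (simp only: mult HK_rep_class rep_word_append)
  qed
  moreover have "HK_rep G f \<one>\<^bsub>HK G\<^esub> = \<one>\<^bsub>End_monoid (pverts G)\<^esub>"
    using HK_rep_class[of "[]" f]
    by (simp add: HK_def presented_monoid_def hk_class_def rep_word_def)
  ultimately show ?thesis by (simp add: representation_def)
qed

end


section \<open>The graphs $Z_n$\<close>

datatype zvertex = A | B | V nat

definition Z :: "nat \<Rightarrow> zvertex pair_pre_digraph" where
  "Z n = \<lparr>pverts = {A, B} \<union> V ` {3..n},
          parcs = {(A, V i) | i. i \<in> {3..n}} \<union> {(V i, B) | i. i \<in> {3..n}}\<rparr>"

lemma hk_digraph_Z: "hk_digraph (Z n)"
proof
  have "parcs (Z n) = (\<lambda>i. (A, V i)) ` {3..n} \<union> (\<lambda>i. (V i, B)) ` {3..n}"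
    by (auto simp: Z_def)
  then show "finite (parcs (Z n))" by simp
qed (auto simp: Z_def)

lemma weight_function_Z:
  fixes f :: "zvertex \<times> zvertex \<Rightarrow> 'r::{idom, ring_char_0}"
  assumes "\<And>i. i \<in> {3..n} \<Longrightarrow> f (A, V i) = 1"
    and "\<And>i. i \<in> {3..n} \<Longrightarrow> f (V i, B) = 2 ^ i"
  shows "weight_function (Z n) f"
  using assms by (auto simp: weight_function_def Z_def)

end

(*
In a word over Z_n only the first A and the last B matter, and between two occurrences of a vertex
V i that cannot be merged there are both an A and a B. Hence every element of the monoid is
represented by a word X, X A Y, X B Y, X A Y B T or X B Y A T, where X, Y, T are products of
commuting vertices V i indexed by sets and Y is disjoint from X and T. The sets are read off the
matrix of the representation. The images of the V i and the vanishing coefficients in the image of B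
give X, Y and T up to one ambiguity: when both A and B occur, they do not tell X from Y. Then the
coefficient of A in the image of B is the sum of 2^i over X, so the binary expansion recovers X.
The only coincidence left is X A B T = X B A T, which holds in
the monoid because A and B commute.
*)
theory Submission
  imports Defs "HOL-Library.Nat_Bijection"
begin

section \<open>Absorption in Hecke-Kiselman monoids\<close>

context hk_digraph
begin

section \<open>Congruence of words and its rules\<close>

definition hk_eq :: "'a list \<Rightarrow> 'a list \<Rightarrow> bool" (infix "\<approx>" 50) where
  "u \<approx> v \<longleftrightarrow> (u, v) \<in> word_cong (pverts G) (hk_relations G)"

lemma hk_eq_rel:
  assumes "(u, v) \<in> hk_relations G" "set u \<subseteq> pverts G" "set v \<subseteq> pverts G"
  shows "u \<approx> v"
  unfolding hk_eq_def using assms by (intro word_cong.rel) auto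

lemma hk_eq_refl: "set u \<subseteq> pverts G \<Longrightarrow> u \<approx> u"
  unfolding hk_eq_def by (intro word_cong.refl) auto

lemma hk_eq_sym: "u \<approx> v \<Longrightarrow> v \<approx> u"
  unfolding hk_eq_def by (rule word_cong.sym)

lemma hk_eq_trans [trans]: "u \<approx> v \<Longrightarrow> v \<approx> w \<Longrightarrow> u \<approx> w"
  unfolding hk_eq_def by (rule word_cong.trans)

lemma hk_eq_context:
  assumes "u \<approx> v" "set p \<subseteq> pverts G" "set q \<subseteq> pverts G"
  shows "p @ u @ q \<approx> p @ v @ q"
  using assms unfolding hk_eq_def by (intro word_cong.append word_cong.refl) auto

lemmas hk_eq_prepend = hk_eq_context[where q = "[]", simplified]
lemmas hk_eq_append = hk_eq_context[where p = "[]", simplified]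

lemma hk_eq_idem: "x \<in> pverts G \<Longrightarrow> [x, x] \<approx> [x]"
  by (rule hk_eq_rel) (auto simp: hk_relations_def)

lemma hk_eq_comm:
  assumes "x \<in> pverts G" "y \<in> pverts G" "(x, y) \<notin> parcs G" "(y, x) \<notin> parcs G"
  shows "[x, y] \<approx> [y, x]"
  using assms by (intro hk_eq_rel) (auto simp: hk_relations_def)

text \<open>Two cases are left once the arc from \<open>y\<close> to \<open>x\<close> is excluded:
  an arc from \<open>x\<close> to \<open>y\<close> makes this a defining relation, and without arcs
  \<open>x\<close> commutes with \<open>y\<close>, so idempotence finishes.\<close>

lemma hk_eq_absorb_last:
  assumes "x \<in> pverts G" "y \<in> pverts G" "(y, x) \<notin> parcs G"
  shows "[x, y, x] \<approx> [x, y]"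
proof (cases "(x, y) \<in> parcs G")
  case True
  with assms show ?thesis by (intro hk_eq_rel) (auto simp: hk_relations_def)
next
  case False
  have "[x] @ [y, x] \<approx> [x] @ [x, y]"
    using assms False by (intro hk_eq_prepend hk_eq_comm) auto
  also have "[x] @ [x, y] \<approx> [x, y]"
    using hk_eq_append[OF hk_eq_idem, of x "[y]"] assms by simp
  finally show ?thesis by simp
qed

lemma hk_eq_absorb_first:
  assumes "x \<in> pverts G" "y \<in> pverts G" "(x, y) \<notin> parcs G"
  shows "[x, y, x] \<approx> [y, x]"
proof (cases "(y, x) \<in> parcs G")
  case True
  with assms show ?thesis by (intro hk_eq_rel) (auto simp: hk_relations_def)
next
  case False
  have "[x, y] @ [x] \<approx> [y, x] @ [x]"
    using assms False by (intro hk_eq_append hk_eq_comm) auto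
  also have "[y, x] @ [x] \<approx> [y, x]"
    using hk_eq_prepend[OF hk_eq_idem, of x "[y]"] assms by simp
  finally show ?thesis by simp
qed

text \<open>A letter that receives no arc from the letters in between is absorbed by its earlier
  occurrence. The induction peels off the letter next to the second \<open>x\<close>.\<close>

lemma hk_eq_delete_last:
  assumes "x \<in> pverts G" "set u \<subseteq> pverts G" "\<forall>y\<in>set u. (y, x) \<notin> parcs G"
  shows "[x] @ u @ [x] \<approx> [x] @ u"
  using assms
proof (induction u rule: rev_induct)
  case Nil
  then show ?case by (simp add: hk_eq_idem)
next
  case (snoc y u)
  then have IH: "[x] @ u @ [x] \<approx> [x] @ u" and xy: "[x, y, x] \<approx> [x, y]"
    by (auto intro: hk_eq_absorb_last)
  \<comment> \<open>The induction hypothesis, read backwards, inserts an auxiliary \<open>x\<close>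
    before \<open>y\<close>, so that \<open>[x, y, x]\<close> can shrink to \<open>[x, y]\<close>;
    read forwards, it then removes the auxiliary letter.\<close>
  have "([x] @ u) @ [y, x] \<approx> ([x] @ u @ [x]) @ [y, x]"
    using snoc.prems by (intro hk_eq_append hk_eq_sym[OF IH]) auto
  also have "([x] @ u @ [x]) @ [y, x] \<approx> ([x] @ u) @ [x, y]"
    using hk_eq_prepend[OF xy, of "[x] @ u"] snoc.prems by simp
  also have "([x] @ u) @ [x, y] \<approx> ([x] @ u) @ [y]"
    using hk_eq_append[OF IH, of "[y]"] snoc.prems by simp
  finally show ?case by simp
qed

text \<open>Mirror image of \<open>hk_eq_delete_last\<close>: with no arc from \<open>x\<close> to
  the letters in between, the later occurrence absorbs the earlier one.\<close>

lemma hk_eq_delete_first: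
  assumes "x \<in> pverts G" "set u \<subseteq> pverts G" "\<forall>y\<in>set u. (x, y) \<notin> parcs G"
  shows "[x] @ u @ [x] \<approx> u @ [x]"
  using assms
proof (induction u)
  case Nil
  then show ?case by (simp add: hk_eq_idem)
next
  case (Cons y u)
  then have IH: "[x] @ u @ [x] \<approx> u @ [x]" and xy: "[x, y, x] \<approx> [y, x]"
    by (auto intro: hk_eq_absorb_first)
  have "[x, y] @ (u @ [x]) \<approx> [x, y] @ ([x] @ u @ [x])"
    using Cons.prems by (intro hk_eq_prepend hk_eq_sym[OF IH]) auto
  also have "[x, y] @ ([x] @ u @ [x]) \<approx> [y, x] @ (u @ [x])"
    using hk_eq_append[OF xy, of "u @ [x]"] Cons.prems by simp
  also have "[y, x] @ (u @ [x]) \<approx> [y] @ (u @ [x])"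
    using hk_eq_prepend[OF IH, of "[y]"] Cons.prems by simp
  finally show ?case by simp
qed

text \<open>Every letter of \<open>p\<close> already occurs in \<open>q\<close>;
  \<open>hk_eq_delete_last\<close>, applied to the part of \<open>q\<close> that starts at such an
  occurrence, removes it.\<close>

lemma hk_eq_absorb_suffix:
  assumes "set p \<subseteq> set q" "set q \<subseteq> pverts G"
    and "\<forall>x\<in>set p. \<forall>y\<in>set q. (y, x) \<notin> parcs G"
  shows "q @ p \<approx> q"
  using assms
proof (induction p rule: rev_induct)
  case Nil
  then show ?case by (auto intro: hk_eq_refl)
next
  case (snoc x p)
  then obtain r s where q: "q = r @ x # s" by (meson in_set_conv_decomp in_mono last_in_set snoc_eq_iff_butlast)
  have "(q @ p) @ [x] \<approx> q @ [x]"
    using snoc by (intro hk_eq_append) auto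
  also have "q @ [x] \<approx> q"
    using hk_eq_prepend[OF hk_eq_delete_last, of x s r] snoc.prems q by auto
  finally show ?case by simp
qed

lemma hk_eq_absorb_prefix:
  assumes "set p \<subseteq> set q" "set q \<subseteq> pverts G"
    and "\<forall>x\<in>set p. \<forall>y\<in>set q. (x, y) \<notin> parcs G"
  shows "p @ q \<approx> q"
  using assms
proof (induction p)
  case Nil
  then show ?case by (auto intro: hk_eq_refl)
next
  case (Cons x p)
  then obtain r s where q: "q = r @ x # s" by (metis in_set_conv_decomp list.set_intros(1) subsetD)
  have "[x] @ (p @ q) \<approx> [x] @ q"
    using Cons by (intro hk_eq_prepend) auto
  also have "[x] @ q \<approx> q"
    using hk_eq_append[OF hk_eq_delete_first, of x r s] Cons.prems q by auto
  finally show ?case by simp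
qed

text \<open>Without arcs between the letters, \<open>u @ v\<close> absorbs \<open>v\<close> on the
  right and \<open>u\<close> on the left. This settles order and multiplicity at once, with no
  sorting of letters.\<close>

lemma hk_eq_commuting:
  assumes "set u = set v" "set v \<subseteq> pverts G" "\<forall>x\<in>set v. \<forall>y\<in>set v. (x, y) \<notin> parcs G"
  shows "u \<approx> v"
proof -
  have "u \<approx> u @ v"
    using assms by (intro hk_eq_sym[OF hk_eq_absorb_suffix]) auto
  also have "u @ v \<approx> v"
    using assms by (intro hk_eq_absorb_prefix) auto
  finally show ?thesis .
qed

text \<open>Lets the rest of the argument work with words instead of congruence classes.\<close>

lemma inj_on_HK_repI:
  assumes "\<And>u v. u \<in> lists (pverts G) \<Longrightarrow> v \<in> lists (pverts G) \<Longrightarrow>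
    rep_word G f u = rep_word G f v \<Longrightarrow> u \<approx> v"
  shows "inj_on (HK_rep G f) (carrier (HK G))"
proof (rule inj_onI)
  fix X Y assume "X \<in> carrier (HK G)" "Y \<in> carrier (HK G)" and eq: "HK_rep G f X = HK_rep G f Y"
  then obtain u v where uv: "u \<in> lists (pverts G)" "v \<in> lists (pverts G)"
    "X = hk_class G u" "Y = hk_class G v"
    by (auto simp: HK_def presented_monoid_def quotient_def hk_class_def)
  then have "u \<approx> v"
    using eq assms by (simp add: HK_rep_class)
  then show "X = Y"
    unfolding uv hk_class_def hk_eq_def by (rule equiv_class_eq[OF equiv_word_cong])
qed

lemma rep_word_append_apply:
  assumes "u \<in> lists (pverts G)" "v \<in> lists (pverts G)" "w \<in> free_module (pverts G)"
  shows "rep_word G f (u @ v) w = rep_word G f u (rep_word G f v w)"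
  using assms by (simp add: rep_word_append End_monoid_def compose_def)

lemma rep_word_mem:
  assumes "u \<in> lists (pverts G)" "w \<in> free_module (pverts G)"
  shows "rep_word G f u w \<in> free_module (pverts G)"
  using rep_word_closed[OF assms(1), of f] assms(2) by (auto simp: End_monoid_def)

end


section \<open>Normal forms of words in $HK_{Z_n}$\<close>

text \<open>The sorted order is just a choice of representative, see \<open>V_word_cong\<close>. On
  infinite sets \<open>sorted_list_of_set\<close> is the empty list, so the bound
  \<open>X \<subseteq> {3..n}\<close> accompanies every use.\<close>

definition V_word :: "nat set \<Rightarrow> zvertex list" where
  "V_word X = map V (sorted_list_of_set X)"

lemma set_V_word: "X \<subseteq> {3..n} \<Longrightarrow> set (V_word X) = V ` X"
  using finite_subset[of X "{3..n}"] by (simp add: V_word_def)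

text \<open>A letter \<open>V i\<close> on both sides of a lone \<open>A\<close> or a lone
  \<open>B\<close> is redundant, whence the disjointness conditions. The sets \<open>X\<close> and
  \<open>T\<close> may overlap, as both \<open>A\<close> and \<open>B\<close> stand between them.
  The forms are not unique: for empty \<open>Y\<close>, the cases \<open>AB\<close> and
  \<open>BA\<close> with the same \<open>X\<close> and \<open>T\<close> are congruent.\<close>

inductive normal :: "nat \<Rightarrow> zvertex list \<Rightarrow> bool" for n where
  none: "X \<subseteq> {3..n} \<Longrightarrow> normal n (V_word X)"
| A: "X \<subseteq> {3..n} \<Longrightarrow> Y \<subseteq> {3..n} \<Longrightarrow> X \<inter> Y = {} \<Longrightarrow> normal n (V_word X @ [A] @ V_word Y)"
| B: "X \<subseteq> {3..n} \<Longrightarrow> Y \<subseteq> {3..n} \<Longrightarrow> X \<inter> Y = {} \<Longrightarrow> normal n (V_word X @ [B] @ V_word Y)"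
| AB: "X \<subseteq> {3..n} \<Longrightarrow> Y \<subseteq> {3..n} \<Longrightarrow> T \<subseteq> {3..n} \<Longrightarrow> Y \<inter> X = {} \<Longrightarrow> Y \<inter> T = {} \<Longrightarrow>
    normal n (V_word X @ [A] @ V_word Y @ [B] @ V_word T)"
| BA: "X \<subseteq> {3..n} \<Longrightarrow> Y \<subseteq> {3..n} \<Longrightarrow> T \<subseteq> {3..n} \<Longrightarrow> Y \<inter> X = {} \<Longrightarrow> Y \<inter> T = {} \<Longrightarrow>
    normal n (V_word X @ [B] @ V_word Y @ [A] @ V_word T)"

locale Z_graph =
  fixes n :: nat
begin

sublocale hk_digraph "Z n"
  by (rule hk_digraph_Z)

abbreviation Z_eq :: "zvertex list \<Rightarrow> zvertex list \<Rightarrow> bool" (infix "\<approx>" 50) where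
  "u \<approx> v \<equiv> hk_eq u v"

lemma V_word_verts: "X \<subseteq> {3..n} \<Longrightarrow> set (V_word X) \<subseteq> pverts (Z n)"
  by (auto simp: set_V_word Z_def)

lemma AB_verts: "A \<in> pverts (Z n)" "B \<in> pverts (Z n)"
  by (simp_all add: Z_def)

lemma V_vert: "i \<in> {3..n} \<Longrightarrow> V i \<in> pverts (Z n)"
  by (simp add: Z_def)

lemma Z_arcs: "(x, y) \<in> parcs (Z n) \<longleftrightarrow> (\<exists>i\<in>{3..n}. x = A \<and> y = V i \<or> x = V i \<and> y = B)"
  by (auto simp: Z_def)

section \<open>Products of the letters \<open>V i\<close>, and cancellation across \<open>A\<close>
  and \<open>B\<close>\<close>

lemma V_word_cong:
  assumes "set u = V ` X" "X \<subseteq> {3..n}"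
  shows "u \<approx> V_word X"
  using assms by (intro hk_eq_commuting) (auto simp: set_V_word Z_def)

lemma V_word_Un:
  assumes "X \<subseteq> {3..n}" "Y \<subseteq> {3..n}"
  shows "V_word X @ V_word Y \<approx> V_word (X \<union> Y)"
  using assms by (intro V_word_cong) (auto simp: set_V_word)

text \<open>Brings the letters to be cancelled next to the separating letter: to the right end when
  they stand before \<open>A\<close>, to the left end when they stand after
  \<open>B\<close>.\<close>

lemma V_word_split:
  assumes "X \<subseteq> {3..n}"
  shows "V_word X \<approx> V_word (X - Y) @ V_word (X \<inter> Y)" "V_word X \<approx> V_word (X \<inter> Y) @ V_word (X - Y)"
  using assms V_word_Un[of "X - Y" "X \<inter> Y"] V_word_Un[of "X \<inter> Y" "X - Y"]
  by (auto simp: Un_Diff_Int Int_Diff_Un intro: hk_eq_sym)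

text \<open>The only arc out of \<open>V i\<close> goes to \<open>B\<close>. Across \<open>A\<close>
  and other letters \<open>V j\<close> the later occurrence therefore absorbs the earlier
  one.\<close>

lemma reduce_A:
  assumes "X \<subseteq> {3..n}" "Y \<subseteq> {3..n}"
  shows "V_word X @ [A] @ V_word Y \<approx> V_word (X - Y) @ [A] @ V_word Y"
proof -
  have sub: "X - Y \<subseteq> {3..n}" "X \<inter> Y \<subseteq> {3..n}" using assms by auto
  have "V_word X @ [A] @ V_word Y \<approx> (V_word (X - Y) @ V_word (X \<inter> Y)) @ [A] @ V_word Y"
    using assms by (intro hk_eq_append V_word_split) (auto simp: AB_verts dest: V_word_verts)
  also have "(V_word (X - Y) @ V_word (X \<inter> Y)) @ [A] @ V_word Y
      = V_word (X - Y) @ (V_word (X \<inter> Y) @ [A] @ V_word Y)" by simp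
  also have "V_word (X - Y) @ (V_word (X \<inter> Y) @ [A] @ V_word Y) \<approx> V_word (X - Y) @ ([A] @ V_word Y)"
    using assms V_word_verts[OF sub(1)] set_V_word[OF sub(2)] set_V_word[OF assms(2)]
    by (intro hk_eq_prepend hk_eq_absorb_prefix) (auto simp: Z_def)
  finally show ?thesis .
qed

text \<open>The only arc into \<open>V i\<close> comes from \<open>A\<close>, so across
  \<open>B\<close> it is the earlier occurrence that survives.\<close>

lemma reduce_B:
  assumes "X \<subseteq> {3..n}" "Y \<subseteq> {3..n}"
  shows "V_word X @ [B] @ V_word Y \<approx> V_word X @ [B] @ V_word (Y - X)"
proof -
  have sub: "Y - X \<subseteq> {3..n}" "Y \<inter> X \<subseteq> {3..n}" using assms by auto
  have "(V_word X @ [B]) @ V_word Y \<approx> (V_word X @ [B]) @ V_word (Y \<inter> X) @ V_word (Y - X)"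
    using assms by (intro hk_eq_prepend V_word_split) (auto simp: AB_verts dest: V_word_verts)
  also have "(V_word X @ [B]) @ V_word (Y \<inter> X) @ V_word (Y - X)
      = ((V_word X @ [B]) @ V_word (Y \<inter> X)) @ V_word (Y - X)" by simp
  also have "((V_word X @ [B]) @ V_word (Y \<inter> X)) @ V_word (Y - X) \<approx> (V_word X @ [B]) @ V_word (Y - X)"
    using assms V_word_verts[OF sub(1)] set_V_word[OF sub(2)] set_V_word[OF assms(1)]
    by (intro hk_eq_append hk_eq_absorb_suffix) (auto simp: Z_def)
  finally show ?thesis by simp
qed

text \<open>\<open>A\<close> is a source, so only its first occurrence counts; dually, in
  \<open>B_absorb\<close>, \<open>B\<close> is a sink and only its last occurrence counts.\<close>

lemma A_absorb:
  assumes "set u \<subseteq> pverts (Z n)"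
  shows "[A] @ u @ [A] \<approx> [A] @ u"
  using assms by (intro hk_eq_delete_last) (auto simp: Z_def)

lemma B_absorb:
  assumes "set u \<subseteq> pverts (Z n)"
  shows "[B] @ u @ [B] \<approx> u @ [B]"
  using assms by (intro hk_eq_delete_first) (auto simp: Z_def)

section \<open>Existence of normal forms\<close>

definition normalizable :: "zvertex list \<Rightarrow> bool" where
  "normalizable w \<longleftrightarrow> (\<exists>u. normal n u \<and> w \<approx> u)"

lemma normalizable_cong: "w \<approx> w' \<Longrightarrow> normalizable w' \<Longrightarrow> normalizable w"
  unfolding normalizable_def by (blast intro: hk_eq_trans)

lemma normalizable_none: "X \<subseteq> {3..n} \<Longrightarrow> normalizable (V_word X)"
  unfolding normalizable_def
  by (intro exI[of _ "V_word X"] conjI normal.none hk_eq_refl) (auto dest: V_word_verts)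

lemma normalizable_A:
  assumes "X \<subseteq> {3..n}" "Y \<subseteq> {3..n}"
  shows "normalizable (V_word X @ [A] @ V_word Y)"
  unfolding normalizable_def using assms
  by (intro exI[of _ "V_word (X - Y) @ [A] @ V_word Y"] conjI normal.A reduce_A) auto

lemma normalizable_B:
  assumes "X \<subseteq> {3..n}" "Y \<subseteq> {3..n}"
  shows "normalizable (V_word X @ [B] @ V_word Y)"
  unfolding normalizable_def using assms
  by (intro exI[of _ "V_word X @ [B] @ V_word (Y - X)"] conjI normal.B reduce_B) auto

text \<open>Here the middle set survives and the outer sets shrink: \<open>reduce_A\<close> removes
  \<open>Y\<close> from \<open>X\<close>, and \<open>reduce_B\<close> removes it from
  \<open>T\<close>.\<close>

lemma normalizable_AB:
  assumes "X \<subseteq> {3..n}" "Y \<subseteq> {3..n}" "T \<subseteq> {3..n}"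
  shows "normalizable (V_word X @ [A] @ V_word Y @ [B] @ V_word T)"
proof -
  have "(V_word X @ [A] @ V_word Y) @ [B] @ V_word T \<approx> (V_word (X - Y) @ [A] @ V_word Y) @ [B] @ V_word T"
    using assms by (intro hk_eq_append reduce_A) (auto simp: AB_verts dest: V_word_verts)
  also have "\<dots> = (V_word (X - Y) @ [A]) @ V_word Y @ [B] @ V_word T" by simp
  also have "\<dots> \<approx> (V_word (X - Y) @ [A]) @ V_word Y @ [B] @ V_word (T - Y)"
    using assms V_word_verts[of "X - Y"] by (intro hk_eq_prepend reduce_B) (auto simp: AB_verts)
  finally show ?thesis
    unfolding normalizable_def using assms
    by (intro exI[of _ "V_word (X - Y) @ [A] @ V_word Y @ [B] @ V_word (T - Y)"] conjI normal.AB) auto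
qed

text \<open>With the separators exchanged it is the middle set that shrinks: its letters are
  absorbed by those of \<open>X\<close> across \<open>B\<close> and by those of \<open>T\<close>
  across \<open>A\<close>.\<close>

lemma normalizable_BA:
  assumes "X \<subseteq> {3..n}" "Y \<subseteq> {3..n}" "T \<subseteq> {3..n}"
  shows "normalizable (V_word X @ [B] @ V_word Y @ [A] @ V_word T)"
proof -
  have "(V_word X @ [B] @ V_word Y) @ [A] @ V_word T \<approx> (V_word X @ [B] @ V_word (Y - X)) @ [A] @ V_word T"
    using assms by (intro hk_eq_append reduce_B) (auto simp: AB_verts dest: V_word_verts)
  also have "\<dots> = (V_word X @ [B]) @ V_word (Y - X) @ [A] @ V_word T" by simp
  also have "\<dots> \<approx> (V_word X @ [B]) @ V_word (Y - X - T) @ [A] @ V_word T"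
    using assms V_word_verts[of X] by (intro hk_eq_prepend reduce_A) (auto simp: AB_verts)
  finally show ?thesis
    unfolding normalizable_def using assms
    by (intro exI[of _ "V_word X @ [B] @ V_word (Y - X - T) @ [A] @ V_word T"] conjI normal.BA) auto
qed

lemma V_word_empty: "V_word {} = []"
  by (simp add: V_word_def)

lemma V_word_insert:
  assumes "i \<in> {3..n}" "X \<subseteq> {3..n}" "set q \<subseteq> pverts (Z n)"
  shows "V i # V_word X @ q \<approx> V_word (insert i X) @ q"
  using hk_eq_append[OF V_word_cong[of "V i # V_word X" "insert i X"], of q] assms
  by (auto simp: set_V_word)

text \<open>The new letter joins the leading set. This may break disjointness, which the lemmas on
  the separate shapes restore.\<close>

lemma normalizable_Cons_V:
  assumes "i \<in> {3..n}" "normal n u"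
  shows "normalizable (V i # u)"
  using assms(2)
proof cases
  case (none X)
  show ?thesis
    using assms(1) none V_word_insert[of i X "[]"]
    by (auto intro!: normalizable_cong[OF _ normalizable_none[of "insert i X"]])
next
  case (A X Y)
  show ?thesis
    using assms(1) A V_word_insert[of i X "[A] @ V_word Y"]
    by (auto simp: AB_verts dest: V_word_verts
        intro!: normalizable_cong[OF _ normalizable_A[of "insert i X" Y]])
next
  case (B X Y)
  show ?thesis
    using assms(1) B V_word_insert[of i X "[B] @ V_word Y"]
    by (auto simp: AB_verts dest: V_word_verts
        intro!: normalizable_cong[OF _ normalizable_B[of "insert i X" Y]])
next
  case (AB X Y T)
  show ?thesis
    using assms(1) AB V_word_insert[of i X "[A] @ V_word Y @ [B] @ V_word T"]
      V_word_verts[of Y] V_word_verts[of T]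
    by (auto simp: AB_verts intro!: normalizable_cong[OF _ normalizable_AB[of "insert i X" Y T]])
next
  case (BA X Y T)
  show ?thesis
    using assms(1) BA V_word_insert[of i X "[B] @ V_word Y @ [A] @ V_word T"]
      V_word_verts[of Y] V_word_verts[of T]
    by (auto simp: AB_verts intro!: normalizable_cong[OF _ normalizable_BA[of "insert i X" Y T]])
qed

lemma normalizable_Cons_A:
  assumes "normal n u"
  shows "normalizable (A # u)"
  using assms
proof cases
  case (none X)
  then show ?thesis using normalizable_A[of "{}" X] by (simp add: V_word_empty)
next
  case (A X Y)
  have "([A] @ V_word X @ [A]) @ V_word Y \<approx> ([A] @ V_word X) @ V_word Y"
    using A by (intro hk_eq_append A_absorb V_word_verts)
  also have "\<dots> = [A] @ V_word X @ V_word Y" by simp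
  also have "\<dots> \<approx> [A] @ V_word (X \<union> Y)"
    using A by (intro hk_eq_prepend V_word_Un) (auto simp: AB_verts)
  finally show ?thesis
    using A normalizable_A[of "{}" "X \<union> Y"] normalizable_cong by (simp add: V_word_empty)
next
  case (B X Y)
  then show ?thesis using normalizable_AB[of "{}" X Y] by (simp add: V_word_empty)
next
  case (AB X Y T)
  have "([A] @ V_word X @ [A]) @ V_word Y @ [B] @ V_word T \<approx> ([A] @ V_word X) @ V_word Y @ [B] @ V_word T"
    using AB V_word_verts[of Y] V_word_verts[of T]
    by (intro hk_eq_append A_absorb V_word_verts) (auto simp: AB_verts)
  also have "\<dots> = [A] @ (V_word X @ V_word Y) @ [B] @ V_word T" by simp
  also have "\<dots> \<approx> [A] @ V_word (X \<union> Y) @ [B] @ V_word T"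
    using AB V_word_verts[of T] by (intro hk_eq_context V_word_Un) (auto simp: AB_verts)
  finally show ?thesis
    using AB normalizable_AB[of "{}" "X \<union> Y" T] normalizable_cong by (simp add: V_word_empty)
next
  case (BA X Y T)
  \<comment> \<open>The new \<open>A\<close> makes the old one redundant, so \<open>B\<close> now
    stands after \<open>A\<close> and the form changes from \<open>BA\<close> to \<open>AB\<close>,
    with \<open>Y\<close> and \<open>T\<close> merged.\<close>
  have "([A] @ (V_word X @ [B] @ V_word Y) @ [A]) @ V_word T \<approx> ([A] @ V_word X @ [B] @ V_word Y) @ V_word T"
    using BA V_word_verts[of Y] V_word_verts[of X]
    by (intro hk_eq_append A_absorb V_word_verts) (auto simp: AB_verts)
  also have "\<dots> = ([A] @ V_word X @ [B]) @ V_word Y @ V_word T" by simp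
  also have "\<dots> \<approx> ([A] @ V_word X @ [B]) @ V_word (Y \<union> T)"
    using BA V_word_verts[of X] by (intro hk_eq_prepend V_word_Un) (auto simp: AB_verts)
  finally show ?thesis
    using BA normalizable_AB[of "{}" X "Y \<union> T"] normalizable_cong by (simp add: V_word_empty)
qed

text \<open>If \<open>u\<close> already contains \<open>B\<close>, the new \<open>B\<close> is
  absorbed and the word is congruent to \<open>u\<close> itself.\<close>

lemma normalizable_Cons_B:
  assumes "normal n u"
  shows "normalizable (B # u)"
  using assms
proof cases
  case (none X)
  then show ?thesis using normalizable_B[of "{}" X] by (simp add: V_word_empty)
next
  case (A X Y)
  then show ?thesis using normalizable_BA[of "{}" X Y] by (simp add: V_word_empty)
next
  case (B X Y)
  have "([B] @ V_word X @ [B]) @ V_word Y \<approx> (V_word X @ [B]) @ V_word Y"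
    using B by (intro hk_eq_append B_absorb V_word_verts)
  then show ?thesis
    using B normalizable_B[of X Y] normalizable_cong by simp
next
  case (AB X Y T)
  have "([B] @ (V_word X @ [A] @ V_word Y) @ [B]) @ V_word T \<approx> ((V_word X @ [A] @ V_word Y) @ [B]) @ V_word T"
    using AB V_word_verts[of X] V_word_verts[of Y]
    by (intro hk_eq_append B_absorb V_word_verts) (auto simp: AB_verts)
  then show ?thesis
    using AB normalizable_AB[of X Y T] normalizable_cong by simp
next
  case (BA X Y T)
  have "([B] @ V_word X @ [B]) @ V_word Y @ [A] @ V_word T \<approx> (V_word X @ [B]) @ V_word Y @ [A] @ V_word T"
    using BA V_word_verts[of T] V_word_verts[of Y]
    by (intro hk_eq_append B_absorb V_word_verts) (auto simp: AB_verts)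
  then show ?thesis
    using BA normalizable_BA[of X Y T] normalizable_cong by simp
qed

lemma ex_normal:
  assumes "w \<in> lists (pverts (Z n))"
  shows "normalizable w"
  using assms
proof (induction w)
  case Nil
  show ?case using normalizable_none[of "{}"] by (simp add: V_word_empty)
next
  case (Cons x w)
  then obtain u where u: "normal n u" "w \<approx> u" unfolding normalizable_def by auto
  have "x # w \<approx> x # u"
    using hk_eq_prepend[OF u(2), of "[x]"] Cons.hyps by simp
  moreover have "normalizable (x # u)"
    using Cons.hyps normalizable_Cons_A[OF u(1)] normalizable_Cons_B[OF u(1)]
      normalizable_Cons_V[OF _ u(1)]
    by (auto simp: Z_def)
  ultimately show ?case by (rule normalizable_cong)
qed

lemma swap_AB:
  assumes "X \<subseteq> {3..n}" "T \<subseteq> {3..n}"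
  shows "V_word X @ [A, B] @ V_word T \<approx> V_word X @ [B, A] @ V_word T"
  using assms by (intro hk_eq_context hk_eq_comm V_word_verts) (auto simp: Z_def)

end


section \<open>Separating the normal forms\<close>

text \<open>The sums are the images of the natural numbers \<open>set_encode X\<close> and
  \<open>set_encode Y\<close>. Characteristic zero brings the equation back to the naturals, where
  binary expansions are unique.\<close>

lemma sum_power2_inject:
  assumes "(\<Sum>i\<in>X. 2 ^ i :: 'r::ring_char_0) = (\<Sum>i\<in>Y. 2 ^ i)" "finite X" "finite Y"
  shows "X = Y"
proof -
  have "of_nat (set_encode X) = (of_nat (set_encode Y) :: 'r)"
    using assms(1) by (simp add: set_encode_def)
  then show ?thesis
    using assms by (simp add: set_encode_eq)
qed

locale Z_weighted = Z_graph n for n :: nat +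
  fixes f :: "zvertex \<times> zvertex \<Rightarrow> 'r::{idom, ring_char_0}"
  assumes weight_A: "i \<in> {3..n} \<Longrightarrow> f (A, V i) = 1"
    and weight_B: "i \<in> {3..n} \<Longrightarrow> f (V i, B) = 2 ^ i"
begin

section \<open>Action of words on coordinate vectors\<close>

abbreviation W :: "(zvertex \<Rightarrow> 'r) set" where
  "W \<equiv> free_module (pverts (Z n))"

abbreviation rep :: "zvertex list \<Rightarrow> (zvertex \<Rightarrow> 'r) \<Rightarrow> (zvertex \<Rightarrow> 'r)" where
  "rep \<equiv> rep_word (Z n) f"

lemma rep_A_Cons:
  assumes "u \<in> lists (pverts (Z n))" "w \<in> W"
  shows "rep (A # u) w = (rep u w)(A := 0)"
  using theta_apply[OF _ rep_word_mem[OF assms], of A f f]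
  by (auto simp: rep_word_apply assms AB_verts fun_eq_iff Z_arcs)

text \<open>The coordinate at \<open>B\<close> is pushed back along the arcs into \<open>B\<close>.
  The guard on \<open>i\<close> is there because the type \<open>zvertex\<close> also contains
  elements \<open>V i\<close> that are not vertices of \<open>Z n\<close>.\<close>

lemma rep_B_Cons:
  assumes "u \<in> lists (pverts (Z n))" "w \<in> W"
  shows "rep (B # u) w = (\<lambda>v. case v of A \<Rightarrow> rep u w A | B \<Rightarrow> 0
    | V i \<Rightarrow> rep u w (V i) + (if i \<in> {3..n} then rep u w B * 2 ^ i else 0))"
  using theta_apply[OF _ rep_word_mem[OF assms], of B f f]
  by (auto simp: rep_word_apply assms AB_verts fun_eq_iff Z_arcs weight_B split: zvertex.split)

lemma rep_V_Cons:
  assumes "i \<in> {3..n}" "u \<in> lists (pverts (Z n))" "w \<in> W"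
  shows "rep (V i # u) w = (\<lambda>v. case v of A \<Rightarrow> rep u w A + rep u w (V i) | B \<Rightarrow> rep u w B
    | V j \<Rightarrow> if j = i then 0 else rep u w (V j))"
  using theta_apply[OF V_vert rep_word_mem[OF assms(2,3)], of i f f] assms(1)
  by (auto simp: rep_word_apply assms(2,3) fun_eq_iff Z_arcs weight_A split: zvertex.split)

text \<open>Applying \<open>V i\<close> moves its coordinate to \<open>A\<close> and leaves zero
  behind. A repetition adds nothing, so the sum ranges over the set of indices and not over the
  list.\<close>

lemma rep_map_V:
  assumes "set xs \<subseteq> {3..n}" "w \<in> W"
  shows "rep (map V xs) w = (\<lambda>v. case v of A \<Rightarrow> w A + (\<Sum>i\<in>set xs. w (V i)) | B \<Rightarrow> w B
    | V i \<Rightarrow> if i \<in> set xs then 0 else w (V i))"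
  using assms
proof (induction xs)
  case Nil
  then show ?case by (auto simp: rep_word_apply fun_eq_iff split: zvertex.split)
next
  case (Cons x xs)
  then have "map V xs \<in> lists (pverts (Z n))" by (auto intro!: V_vert)
  with Cons show ?case
    by (auto simp: rep_V_Cons fun_eq_iff insert_absorb split: zvertex.split)
qed

lemma rep_V_word_append:
  assumes "X \<subseteq> {3..n}" "u \<in> lists (pverts (Z n))" "w \<in> W"
  shows "rep (V_word X @ u) w = (\<lambda>v. case v of A \<Rightarrow> rep u w A + (\<Sum>i\<in>X. rep u w (V i)) | B \<Rightarrow> rep u w B
    | V i \<Rightarrow> if i \<in> X then 0 else rep u w (V i))"
proof -
  have "finite X" using assms(1) finite_subset by blast
  moreover have "V_word X \<in> lists (pverts (Z n))" using V_word_verts[OF assms(1)] by auto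
  ultimately show ?thesis
    using rep_map_V[of "sorted_list_of_set X", OF _ rep_word_mem[OF assms(2,3), of f]] assms
    by (simp add: rep_word_append_apply V_word_def)
qed

lemma rep_V_word:
  assumes "X \<subseteq> {3..n}" "w \<in> W"
  shows "rep (V_word X) w = (\<lambda>v. case v of A \<Rightarrow> w A + (\<Sum>i\<in>X. w (V i)) | B \<Rightarrow> w B
    | V i \<Rightarrow> if i \<in> X then 0 else w (V i))"
  using rep_V_word_append[OF assms(1) _ assms(2), of "[]"] assms(2)
  by (auto simp: rep_word_apply fun_eq_iff split: zvertex.split)

lemma basis_vec_mem: "v \<in> pverts (Z n) \<Longrightarrow> basis_vec v \<in> W"
  by (auto simp: free_module_def basis_vec_def)

lemma V_word_lists: "X \<subseteq> {3..n} \<Longrightarrow> V_word X \<in> lists (pverts (Z n))"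
  using V_word_verts by auto

lemmas rep_simps = rep_A_Cons rep_B_Cons rep_V_word_append rep_V_word basis_vec_mem V_word_lists
  AB_verts V_vert

lemma basis_vec_apply [simp]: "basis_vec x y = (if y = x then 1 else 0)"
  by (simp add: basis_vec_def)

text \<open>Such sums form the coefficient of \<open>A\<close> in the image of the basis vector at
  \<open>V i\<close>. The nested conditionals record the coordinates already erased by sets standing
  further right in the word.\<close>

lemma sum_delta_outside:
  fixes c :: 'r
  assumes "X \<subseteq> {3..n}"
  shows "(\<Sum>j\<in>X. if j \<in> Y then 0 else if j = i then c else 0) = (if i \<in> X - Y then c else 0)" (is ?one)
    and "(\<Sum>j\<in>X. if j \<in> Y then 0 else if j \<in> T then 0 else if j = i then c else 0) =
      (if i \<in> X - Y - T then c else 0)" (is ?two)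
proof -
  have "(\<Sum>j\<in>X. if j \<in> S then 0 else if j = i then c else 0) = (\<Sum>j\<in>X. if j = i then if i \<in> S then 0 else c else 0)" for S
    by (rule sum.cong) auto
  then have one: "(\<Sum>j\<in>X. if j \<in> S then 0 else if j = i then c else 0) = (if i \<in> X - S then c else 0)" for S
    using finite_subset[OF assms] by simp
  have "(if j \<in> Y then 0 else if j \<in> T then 0 else if j = i then c else 0) =
      (if j \<in> Y \<union> T then 0 else if j = i then c else 0)" for j
    by simp
  with one[of Y] one[of "Y \<union> T"] show ?one ?two by auto
qed

text \<open>The analogous sums for the image of the basis vector at \<open>B\<close>; the range
  conditions come from \<open>rep_B_Cons\<close>.\<close>

lemma sum_powers:
  assumes "X \<subseteq> {3..n}"
  shows "(\<Sum>j\<in>X. if 3 \<le> j \<and> j \<le> n then (2::'r) ^ j else 0) = (\<Sum>j\<in>X. 2 ^ j)"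
    and "Y \<inter> X = {} \<Longrightarrow>
      (\<Sum>j\<in>X. if j \<in> Y then 0 else if 3 \<le> j \<and> j \<le> n then (2::'r) ^ j else 0) = (\<Sum>j\<in>X. 2 ^ j)"
proof -
  have "3 \<le> j \<and> j \<le> n" if "j \<in> X" for j using assms that by auto
  then show "(\<Sum>j\<in>X. if 3 \<le> j \<and> j \<le> n then (2::'r) ^ j else 0) = (\<Sum>j\<in>X. 2 ^ j)"
    and "Y \<inter> X = {} \<Longrightarrow>
      (\<Sum>j\<in>X. if j \<in> Y then 0 else if 3 \<le> j \<and> j \<le> n then (2::'r) ^ j else 0) = (\<Sum>j\<in>X. 2 ^ j)"
    by (auto intro!: sum.cong)
qed

text \<open>The first vertex is the row and the second the column: \<open>entry u A B\<close> is the
  coefficient of \<open>A\<close> in the image of \<open>B\<close>.\<close>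

abbreviation entry :: "zvertex list \<Rightarrow> zvertex \<Rightarrow> zvertex \<Rightarrow> 'r" where
  "entry u y x \<equiv> rep u (basis_vec x) y"

section \<open>Matrix entries of the normal forms\<close>

lemma rep_eq_entry: "rep u = rep v \<Longrightarrow> entry u x y = entry v x y"
  by simp

text \<open>In this and the following lemmas the entries at \<open>A A\<close> and
  \<open>B B\<close> record whether the letters \<open>A\<close> and \<open>B\<close> are absent.
  They separate all shapes except \<open>AB\<close> from \<open>BA\<close>.\<close>

lemma entries_none:
  assumes "X \<subseteq> {3..n}"
  shows "entry (V_word X) A A = 1" "entry (V_word X) B B = 1"
    "i \<in> {3..n} \<Longrightarrow> entry (V_word X) (V i) (V i) = of_bool (i \<notin> X)"
  using assms by (simp_all add: rep_simps)

text \<open>The letter \<open>A\<close> erases whatever \<open>Y\<close> adds to the coordinate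
  \<open>A\<close>, so row \<open>A\<close> sees \<open>X\<close> alone. Disjointness then extracts
  \<open>Y\<close> from the diagonal.\<close>

lemma entries_A:
  assumes "X \<subseteq> {3..n}" "Y \<subseteq> {3..n}" "X \<inter> Y = {}"
  defines "u \<equiv> V_word X @ [A] @ V_word Y"
  shows "entry u A A = 0" "entry u B B = 1"
    "i \<in> {3..n} \<Longrightarrow> entry u (V i) (V i) = of_bool (i \<notin> X \<union> Y)"
    "i \<in> {3..n} \<Longrightarrow> entry u A (V i) = of_bool (i \<in> X)"
  using assms by (auto simp: rep_simps sum_delta_outside cong: if_cong)

lemma entries_B:
  assumes "X \<subseteq> {3..n}" "Y \<subseteq> {3..n}" "X \<inter> Y = {}"
  defines "u \<equiv> V_word X @ [B] @ V_word Y"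
  shows "entry u A A = 1" "entry u B B = 0"
    "i \<in> {3..n} \<Longrightarrow> entry u (V i) (V i) = of_bool (i \<notin> X \<union> Y)"
    "i \<in> {3..n} \<Longrightarrow> entry u (V i) B = (if i \<in> X then 0 else 2 ^ i)"
  using assms by (auto simp: rep_simps sum_delta_outside cong: if_cong)

text \<open>In column \<open>B\<close>, the coordinates removed by \<open>Y\<close> stay removed,
  while their contribution to \<open>A\<close> is erased by the letter \<open>A\<close>. Hence the
  zeros at the \<open>V i\<close> show \<open>X \<union> Y\<close>, but the entry at
  \<open>A\<close> is a sum over \<open>X\<close> only.\<close>

lemma entries_AB:
  assumes "X \<subseteq> {3..n}" "Y \<subseteq> {3..n}" "T \<subseteq> {3..n}" "Y \<inter> X = {}" "Y \<inter> T = {}"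
  defines "u \<equiv> V_word X @ [A] @ V_word Y @ [B] @ V_word T"
  shows "entry u A A = 0" "entry u B B = 0"
    "i \<in> {3..n} \<Longrightarrow> entry u (V i) (V i) = of_bool (i \<notin> X \<union> Y \<union> T)"
    "i \<in> {3..n} \<Longrightarrow> entry u A (V i) = of_bool (i \<in> X - T)"
    "i \<in> {3..n} \<Longrightarrow> entry u (V i) B = (if i \<in> X \<union> Y then 0 else 2 ^ i)"
    "entry u A B = (\<Sum>i\<in>X. 2 ^ i)"
  using assms by (auto simp: rep_simps sum_delta_outside sum_powers cong: if_cong)

text \<open>Now \<open>Y\<close> acts before \<open>B\<close>, where it fixes the basis vector at
  \<open>B\<close>, and after \<open>A\<close>, so its contributions to row \<open>A\<close>
  survive. Compared with \<open>entries_AB\<close>, row \<open>A\<close> and column \<open>B\<close>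
  exchange the roles of \<open>X\<close> and \<open>X \<union> Y\<close>.\<close>

lemma entries_BA:
  assumes "X \<subseteq> {3..n}" "Y \<subseteq> {3..n}" "T \<subseteq> {3..n}" "Y \<inter> X = {}" "Y \<inter> T = {}"
  defines "u \<equiv> V_word X @ [B] @ V_word Y @ [A] @ V_word T"
  shows "entry u A A = 0" "entry u B B = 0"
    "i \<in> {3..n} \<Longrightarrow> entry u (V i) (V i) = of_bool (i \<notin> X \<union> Y \<union> T)"
    "i \<in> {3..n} \<Longrightarrow> entry u A (V i) = of_bool (i \<in> X \<union> Y - T)"
    "i \<in> {3..n} \<Longrightarrow> entry u (V i) B = (if i \<in> X then 0 else 2 ^ i)"
    "entry u A B = (\<Sum>i\<in>X. 2 ^ i)"
  using assms by (auto simp: rep_simps sum_delta_outside sum_powers cong: if_cong)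

section \<open>Recovering the index sets from the matrix\<close>

lemma subset_eqI:
  assumes "X \<subseteq> {3..n}" "Y \<subseteq> {3..n}" "\<And>i. i \<in> {3..n} \<Longrightarrow> i \<in> X \<longleftrightarrow> i \<in> Y"
  shows "X = Y"
  using assms by blast

lemma AB_BA_rep_eq:
  assumes X: "X \<subseteq> {3..n}" "Y \<subseteq> {3..n}" "T \<subseteq> {3..n}" "Y \<inter> X = {}" "Y \<inter> T = {}"
    and X': "X' \<subseteq> {3..n}" "Y' \<subseteq> {3..n}" "T' \<subseteq> {3..n}" "Y' \<inter> X' = {}" "Y' \<inter> T' = {}"
    and eq: "rep (V_word X @ [A] @ V_word Y @ [B] @ V_word T) = rep (V_word X' @ [B] @ V_word Y' @ [A] @ V_word T')"
      (is "rep ?u = rep ?v")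
  shows "?u \<approx> ?v"
proof -
  note e = rep_eq_entry[OF eq]
  have XX: "X = X'"
    using e[where x = A and y = B] unfolding entries_AB(6)[OF X] entries_BA(6)[OF X']
    by (rule sum_power2_inject) (use X X' in \<open>auto intro: finite_subset\<close>)
  have 1: "i \<in> X \<union> Y \<union> T \<longleftrightarrow> i \<in> X' \<union> Y' \<union> T'" "i \<in> X - T \<longleftrightarrow> i \<in> X' \<union> Y' - T'"
    "i \<in> X \<union> Y \<longleftrightarrow> i \<in> X'" if "i \<in> {3..n}" for i
    using e[where x = "V i" and y = "V i"] e[where x = A and y = "V i"] e[where x = "V i" and y = B]
    unfolding entries_AB(3-5)[OF X that] entries_BA(3-5)[OF X' that] of_bool_eq_iff
    by (simp_all split: if_splits) blast+
  \<comment> \<open>Column \<open>B\<close> gives \<open>X \<union> Y = X'\<close>, which is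
    \<open>X\<close>, and \<open>Y\<close> is disjoint from \<open>X\<close>.\<close>
  have Y: "Y = {}" using 1(3) XX X by blast
  \<comment> \<open>In row \<open>A\<close>, an element of \<open>Y'\<close> lies outside
    \<open>T'\<close>, hence in \<open>X - T\<close>, contradicting disjointness from
    \<open>X' = X\<close>.\<close>
  have Y': "Y' = {}" using 1(2) XX X' by blast
  \<comment> \<open>The diagonal determines \<open>T\<close> outside \<open>X\<close>, and row
    \<open>A\<close> determines it inside \<open>X\<close>.\<close>
  have "T = T'"
    using 1(1,2) X X' unfolding XX Y Y' by (intro subset_eqI) blast+
  then show ?thesis
    using swap_AB[OF X(1,3)] XX Y Y' by (simp add: V_word_empty)
qed

text \<open>The conclusion is congruence and not equality because of the overlap between the shapes
  \<open>AB\<close> and \<open>BA\<close>; in all other matching cases the words coincide.\<close>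

lemma normal_rep_eq:
  assumes "normal n u" "normal n v" and eq: "rep u = rep v"
  shows "u \<approx> v"
proof -
  note e = rep_eq_entry[OF eq]
  have AA: "entry u A A = entry v A A" and BB: "entry u B B = entry v B B" by (simp_all add: eq)
  \<comment> \<open>Congruence is reflexive only on words over the vertices, which normality of
    \<open>u\<close> guarantees.\<close>
  have refl: "u \<approx> v" if "u = v"
    using that \<open>normal n u\<close>
    by (auto elim!: normal.cases intro!: hk_eq_refl dest: subsetD[OF V_word_verts] simp: AB_verts)
  from assms(1) show ?thesis
  proof cases
    case u: (none X)
    from assms(2) show ?thesis
    proof cases
      case v: (none X')
      have "X = X'"
      proof (rule subset_eqI[OF u(2) v(2)])
        fix i assume i: "i \<in> {3..n}"
        show "i \<in> X \<longleftrightarrow> i \<in> X'"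
          using e[where x = "V i" and y = "V i"] unfolding u(1) v(1) entries_none(3)[OF u(2) i]
            entries_none(3)[OF v(2) i] of_bool_eq_iff by blast
      qed
      then show ?thesis using refl u v by simp
    \<comment> \<open>Different shapes would force 0 = 1 in one of the two entries. Removing the
      append rules from the simplifier keeps the words in the form used by the entry lemmas.\<close>
    qed (use AA BB u in \<open>simp_all add: entries_none entries_A entries_B entries_AB entries_BA
        del: append.simps append_assoc\<close>)
  next
    case u: (A X Y)
    from assms(2) show ?thesis
    proof cases
      case v: (A X' Y')
      have 1: "i \<in> X \<longleftrightarrow> i \<in> X'" "i \<in> X \<union> Y \<longleftrightarrow> i \<in> X' \<union> Y'" if "i \<in> {3..n}" for i
        using e[where x = A and y = "V i"] e[where x = "V i" and y = "V i"] that unfolding u(1) v(1)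
        by (simp_all only: entries_A u(2-) v(2-) of_bool_eq_iff) blast+
      have "X = X'"
        using 1(1) u v by (intro subset_eqI) blast+
      moreover have "Y = Y'"
        using 1(2) u v unfolding \<open>X = X'\<close> by (intro subset_eqI) blast+
      ultimately show ?thesis using refl u v by simp
    qed (use AA BB u in \<open>simp_all add: entries_none entries_A entries_B entries_AB entries_BA
        del: append.simps append_assoc\<close>)
  next
    case u: (B X Y)
    from assms(2) show ?thesis
    proof cases
      case v: (B X' Y')
      have 1: "i \<in> X \<longleftrightarrow> i \<in> X'" "i \<in> X \<union> Y \<longleftrightarrow> i \<in> X' \<union> Y'" if "i \<in> {3..n}" for i
        using e[where x = "V i" and y = B] e[where x = "V i" and y = "V i"] that unfolding u(1) v(1)
        by (simp_all only: entries_B u(2-) v(2-) of_bool_eq_iff) (auto split: if_splits)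
      have "X = X'"
        using 1(1) u v by (intro subset_eqI) blast+
      moreover have "Y = Y'"
        using 1(2) u v unfolding \<open>X = X'\<close> by (intro subset_eqI) blast+
      ultimately show ?thesis using refl u v by simp
    qed (use AA BB u in \<open>simp_all add: entries_none entries_A entries_B entries_AB entries_BA
        del: append.simps append_assoc\<close>)
  next
    case u: (AB X Y T)
    from assms(2) show ?thesis
    proof cases
      case v: (AB X' Y' T')
      have "X = X'"
        using e[where x = A and y = B] unfolding u(1) v(1) entries_AB(6)[OF u(2-)] entries_AB(6)[OF v(2-)]
        by (rule sum_power2_inject) (use u v in \<open>auto intro: finite_subset\<close>)
      \<comment> \<open>The three equivalences come from the diagonal, row \<open>A\<close> and
        column \<open>B\<close>. The last one compares zero patterns, as powers of 2 are
        nonzero.\<close>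
      have 1: "i \<in> X \<union> Y \<union> T \<longleftrightarrow> i \<in> X' \<union> Y' \<union> T'" "i \<in> X - T \<longleftrightarrow> i \<in> X' - T'"
        "i \<in> X \<union> Y \<longleftrightarrow> i \<in> X' \<union> Y'" if "i \<in> {3..n}" for i
        using e[where x = "V i" and y = "V i"] e[where x = A and y = "V i"] e[where x = "V i" and y = B]
        unfolding u(1) v(1) entries_AB(3-5)[OF u(2-) that] entries_AB(3-5)[OF v(2-) that] of_bool_eq_iff
        by (simp_all split: if_splits) blast+
      have "Y = Y'"
        using 1(3) u v unfolding \<open>X = X'\<close> by (intro subset_eqI) blast+
      moreover have "T = T'"
      proof (rule subset_eqI[OF u(4) v(4)])
        fix i assume "i \<in> {3..n}"
        \<comment> \<open>Inside \<open>X\<close> row \<open>A\<close> decides membership in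
          \<open>T\<close>, outside \<open>X \<union> Y\<close> the diagonal does, and
          \<open>Y\<close> is disjoint from \<open>T\<close>.\<close>
        from 1(1,2)[OF this] show "i \<in> T \<longleftrightarrow> i \<in> T'"
          using u(6) v(6) unfolding \<open>X = X'\<close> \<open>Y = Y'\<close> by blast
      qed
      ultimately show ?thesis using refl u v \<open>X = X'\<close> by simp
    next
      case v: (BA X' Y' T')
      show ?thesis
        using AB_BA_rep_eq[OF u(2-) v(2-)] eq unfolding u(1) v(1) .
    qed (use AA BB u in \<open>simp_all add: entries_none entries_A entries_B entries_AB entries_BA
        del: append.simps append_assoc\<close>)
  next
    case u: (BA X Y T)
    from assms(2) show ?thesis
    proof cases
      case v: (AB X' Y' T')
      show ?thesis
        using AB_BA_rep_eq[OF v(2-) u(2-)] eq hk_eq_sym unfolding u(1) v(1) by simp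
    next
      case v: (BA X' Y' T')
      have "X = X'"
        using e[where x = A and y = B] unfolding u(1) v(1) entries_BA(6)[OF u(2-)] entries_BA(6)[OF v(2-)]
        by (rule sum_power2_inject) (use u v in \<open>auto intro: finite_subset\<close>)
      have 1: "i \<in> X \<union> Y \<union> T \<longleftrightarrow> i \<in> X' \<union> Y' \<union> T'" "i \<in> X \<union> Y - T \<longleftrightarrow> i \<in> X' \<union> Y' - T'"
        if "i \<in> {3..n}" for i
        using e[where x = "V i" and y = "V i"] e[where x = A and y = "V i"]
        unfolding u(1) v(1) entries_BA(3-4)[OF u(2-) that] entries_BA(3-4)[OF v(2-) that] of_bool_eq_iff
        by simp_all blast
      \<comment> \<open>\<open>T\<close> consists of the indices with zero diagonal entry and zero
        entry in row \<open>A\<close>.\<close>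
      have "T = T'"
        using 1 u v unfolding \<open>X = X'\<close> by (intro subset_eqI) blast+
      moreover have "Y = Y'"
        using 1(1) u v unfolding \<open>X = X'\<close> \<open>T = T'\<close> by (intro subset_eqI) blast+
      ultimately show ?thesis using refl u v \<open>X = X'\<close> by simp
    qed (use AA BB u in \<open>simp_all add: entries_none entries_A entries_B entries_AB entries_BA
        del: append.simps append_assoc\<close>)
  qed
qed

lemma rep_eq_imp_hk_eq:
  assumes "u \<in> lists (pverts (Z n))" "v \<in> lists (pverts (Z n))" "rep u = rep v"
  shows "u \<approx> v"
proof -
  obtain u' v' where u': "normal n u'" "u \<approx> u'" and v': "normal n v'" "v \<approx> v'"
    using ex_normal assms(1,2) unfolding normalizable_def by blast
  then have "rep u' = rep v'"
    using assms(3) rep_word_cong[of u u' f] rep_word_cong[of v v' f] by (simp add: hk_eq_def)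
  with u' v' show ?thesis
    by (blast intro: normal_rep_eq hk_eq_trans hk_eq_sym)
qed

end

theorem theorem5p1:
  fixes n :: nat
    and f :: "zvertex \<times> zvertex \<Rightarrow> 'r::{idom, ring_char_0}"
  assumes "n \<ge> 3"
    and "\<And>i. i \<in> {3..n} \<Longrightarrow> f (A, V i) = 1"
    and "\<And>i. i \<in> {3..n} \<Longrightarrow> f (V i, B) = 2 ^ i"
  shows "effective_representation (HK (Z n)) (pverts (Z n)) (HK_rep (Z n) f)"
proof -
  interpret Z_weighted n f
    using assms by unfold_locales
  show ?thesis
    unfolding effective_representation_def
    using representation_HK_rep inj_on_HK_repI rep_eq_imp_hk_eq by blast
qed

end
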